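(* For all $n\geq0$, the classes $E(\alpha_n)$ and $E(\beta_n)$ belong to $\mathcal{E}$.
   Context: Let $P_0=0$, $P_1=1$, $P_n=2P_{n-1}+P_{n-2}$ (Pell numbers) and $H_0=1$, $H_1=1$, $H_n=2H_{n-1}+H_{n-2}$. For $n\geq0$ let $\alpha_n=2P_{n+1}^2/H_n^2$ if $n$ is even and $\alpha_n=H_{n+1}^2/(2P_n^2)$ if $n$ is odd; let $\beta_n=H_{n+2}/H_n$ if $n$ is even and $\beta_n=P_{n+2}/P_n$ if $n$ is odd. Write $\alpha_n=p_n/q_n$ and $\beta_n=p'_n/q'_n$ in lowest terms. Weight expansion: for rational $a\geq1$ with continued fraction $[l_0;l_1,\dots,l_N]$ ($l_N\geq2$ if $N\geq1$), $w(a)=(1^{\times l_0},x_1^{\times l_1},\dots,x_N^{\times l_N})$ with $x_0=1$, $x_1=a-l_0$, $x_i=x_{i-2}-l_{i-1}x_{i-1}$; $x^{\times l}$ is $x$ repeated $l$ times. Let $W'(\alpha_n)$ be the vector $q_nw(\alpha_n)$ with an extra entry $1$ appended at the end, and $W(\beta_n)=q'_nw(\beta_n)$. Define $E(\alpha_n)=(P_{n+1}H_n,P_{n+1}H_n;W'(\alpha_n))$ for $n$ even, $E(\alpha_n)=(P_nH_{n+1},P_nH_{n+1};W'(\alpha_n))$ for $n$ odd; $E(\beta_n)=\big(\tfrac14(H_n+H_{n+2}),\tfrac14(H_n+H_{n+2});W(\beta_n)\big)$ for $n$ even, $E(\beta_n)=\big(\tfrac14(P_n+P_{n+2})+\tfrac12,\tfrac14(P_n+P_{n+2})-\tfrac12;W(\beta_n)\big)$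 for $n$ odd. (For example $E(\alpha_1)=(3,3;2^{\times4},1^{\times3})$, $E(\beta_3)=(9,8;5^{\times5},4,1^{\times4})$.) The set $\mathcal{E}$: a Cremona transform of an integer tuple $(\delta;n_1,\dots,n_k)$ with $n_1\geq\dots\geq n_k$ is $(2\delta-n_1-n_2-n_3;\delta-n_2-n_3,\delta-n_1-n_3,\delta-n_1-n_2,n_4,\dots,n_k)$; a Cremona move is a Cremona transform followed by a permutation of the entries after the semicolon. $\mathcal{E}$ consists of $(0,0;-1)$ together with all integer tuples $(d,e;m_1,\dots,m_M)$ with $d,e\geq0$, $m_1\geq\dots\geq m_M\geq0$, satisfying $\sum m_i=2(d+e)-1$, $\sum m_i^2=2de+1$, and such that $(d+e-m_1;d-m_1,e-m_1,m_2,\dots,m_M)$ reduces to $(0;-1,0,\dots,0)$ by repeated Cremona moves. *)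

theory Defs
  imports Complex_Main "HOL-Library.Multiset"
begin

fun pell :: "nat \<Rightarrow> int" where
  "pell 0 = 0"
| "pell (Suc 0) = 1"
| "pell (Suc (Suc n)) = 2 * pell (Suc n) + pell n"

fun hpell :: "nat \<Rightarrow> int" where
  "hpell 0 = 1"
| "hpell (Suc 0) = 1"
| "hpell (Suc (Suc n)) = 2 * hpell (Suc n) + hpell n"

definition alpha :: "nat \<Rightarrow> rat" where
  "alpha n = (if even n then 2 * of_int (pell (n+1))^2 / of_int (hpell n)^2
              else of_int (hpell (n+1))^2 / (2 * of_int (pell n)^2))"

definition beta :: "nat \<Rightarrow> rat" where
  "beta n = (if even n then of_int (hpell (n+2)) / of_int (hpell n)
             else of_int (pell (n+2)) / of_int (pell n))"

text \<open>Euclidean algorithm on a pair of naturals; for p/q in lowest terms with q>0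
  it yields the canonical continued fraction [l0; l1, ..., lN] (lN \<ge> 2 if N \<ge> 1).\<close>
function cf_nat :: "nat \<Rightarrow> nat \<Rightarrow> nat list" where
  "cf_nat p q = (if q = 0 then [] else (p div q) # cf_nat q (p mod q))"
  by pat_completeness auto
termination by (relation "measure snd") auto

definition cf :: "rat \<Rightarrow> nat list" where
  "cf a = (case quotient_of a of (p, q) \<Rightarrow> cf_nat (nat p) (nat q))"

fun wx :: "rat \<Rightarrow> nat list \<Rightarrow> nat \<Rightarrow> rat" where
  "wx a ls 0 = 1"
| "wx a ls (Suc 0) = a - of_nat (ls ! 0)"
| "wx a ls (Suc (Suc i)) = wx a ls i - of_nat (ls ! Suc i) * wx a ls (Suc i)"

definition weight :: "rat \<Rightarrow> rat list" where
  "weight a = (let ls = cf a in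
     concat (map (\<lambda>i. replicate (ls ! i) (wx a ls i)) [0..<length ls]))"

definition numer :: "rat \<Rightarrow> int" where "numer a = fst (quotient_of a)"
definition denom :: "rat \<Rightarrow> int" where "denom a = snd (quotient_of a)"

type_synonym rclass = "rat \<times> rat \<times> rat list"
type_synonym iclass = "int \<times> int \<times> int list"

definition W' :: "nat \<Rightarrow> rat list" where
  "W' n = map (\<lambda>x. of_int (denom (alpha n)) * x) (weight (alpha n)) @ [1]"

definition W :: "nat \<Rightarrow> rat list" where
  "W n = map (\<lambda>x. of_int (denom (beta n)) * x) (weight (beta n))"

definition E_alpha :: "nat \<Rightarrow> rclass" where
  "E_alpha n = (if even n
     then (of_int (pell (n+1) * hpell n), of_int (pell (n+1) * hpell n), W' n)
     else (of_int (pell n * hpell (n+1)), of_int (pell n * hpell (n+1)), W' n))"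

definition E_beta :: "nat \<Rightarrow> rclass" where
  "E_beta n = (if even n
     then (of_int (hpell n + hpell (n+2)) / 4, of_int (hpell n + hpell (n+2)) / 4, W n)
     else (of_int (pell n + pell (n+2)) / 4 + 1/2, of_int (pell n + pell (n+2)) / 4 - 1/2, W n))"

definition rat_of_class :: "iclass \<Rightarrow> rclass" where
  "rat_of_class c = (case c of (d, e, ms) \<Rightarrow> (of_int d, of_int e, map of_int ms))"

text \<open>Cremona transform of (\<delta>; n1, ..., nk), k \<ge> 3, n1 \<ge> ... \<ge> nk.\<close>
definition cremona :: "int \<Rightarrow> int list \<Rightarrow> int \<times> int list" where
  "cremona \<delta> ns = (2*\<delta> - ns!0 - ns!1 - ns!2,
      [\<delta> - ns!1 - ns!2, \<delta> - ns!0 - ns!2, \<delta> - ns!0 - ns!1] @ drop 3 ns)"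

text \<open>One step: a Cremona move (transform of a nonincreasingly ordered tuple followed
  by a permutation), or a mere permutation of the entries after the semicolon
  (tuples being considered up to reordering of these entries).\<close>
definition crem_step :: "int \<times> int list \<Rightarrow> int \<times> int list \<Rightarrow> bool" where
  "crem_step x y \<longleftrightarrow>
     (fst y = fst x \<and> mset (snd y) = mset (snd x)) \<or>
     (length (snd x) \<ge> 3 \<and> sorted_wrt (\<ge>) (snd x) \<and>
      fst y = fst (cremona (fst x) (snd x)) \<and>
      mset (snd y) = mset (snd (cremona (fst x) (snd x))))"

definition reduces :: "int \<times> int list \<Rightarrow> bool" where
  "reduces x \<longleftrightarrow> crem_step\<^sup>*\<^sup>* x (0, (-1) # replicate (length (snd x) - 1) 0)"

definition ECal :: "iclass set" where
  "ECal = {(0, 0, [-1])} \<union>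
     {(d, e, ms). d \<ge> 0 \<and> e \<ge> 0 \<and> ms \<noteq> [] \<and> sorted_wrt (\<ge>) ms \<and> last ms \<ge> 0 \<and>
        sum_list ms = 2*(d+e) - 1 \<and> sum_list (map (\<lambda>m. m^2) ms) = 2*d*e + 1 \<and>
        reduces (d + e - hd ms, [d - hd ms, e - hd ms] @ tl ms)}"

end

theory Submission
  imports Defs
begin

text \<open>
  The weights are the output of the Euclidean algorithm, and the continued fractions are (nearly)
  periodic with period \<open>4, 1\<close>. Four Cremona moves remove one such period
  \<open>A\<^sup>4, A - B\<close> from the front of the tuple and leave a tuple of the same shape with a shorter
  continued fraction. For \<open>\<beta>\<close> the moves leave nothing behind but zeros, and the reduction descends
  to a trivial tuple. For \<open>\<alpha>\<close>, where the continued fraction is almost symmetric, removing a period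
  on the large side leaves behind a copy of the corresponding period of the small side; when
  the middle is reached, the small side has been doubled, and this doubled tail of balancing
  numbers \<open>0, 1, 6, 35, \<dots>\<close> reduces by a second, simpler descent.
\<close>

section \<open>Reduction of multisets\<close>

text \<open>The rules build a reduction backwards, from its target up to the tuple to be reduced.
  Multisets absorb the permutations, and \<open>good_zero\<close> makes the number of zero entries
  irrelevant. In \<open>good_move\<close> the entries \<open>a\<close>, \<open>b\<close>,
  \<open>c\<close> are three largest ones.\<close>

inductive good :: "int \<Rightarrow> int multiset \<Rightarrow> bool" where
  good_base: "good 0 {#-1#}"
| good_zero: "good d M \<Longrightarrow> good d (add_mset 0 M)"
| good_move: "good (2 * d - a - b - c) ({#d - b - c, d - a - c, d - a - b#} + R) \<Longrightarrow>
    b \<le> a \<Longrightarrow> c \<le> b \<Longrightarrow> 0 \<le> c \<Longrightarrow> (\<And>x. x \<in># R \<Longrightarrow> x \<le> c) \<Longrightarrow> good d ({#a, b, c#} + R)"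

lemma reduces_mset_cong:
  assumes "mset xs = mset ys" and "reduces (d, ys)"
  shows "reduces (d, xs)"
proof -
  have "crem_step (d, xs) (d, ys)"
    using assms by (simp add: crem_step_def)
  moreover have "length xs = length ys"
    using assms(1) by (rule mset_eq_length)
  ultimately show ?thesis
    using assms(2) by (simp add: reduces_def converse_rtranclp_into_rtranclp)
qed

text \<open>The length of the actual tuple is fixed, so a zero added by \<open>good_zero\<close> has
  to be there throughout; the induction therefore carries \<open>k\<close> spare zeros along. The
  condition \<open>0 \<le> c\<close> keeps them behind the three entries being moved.\<close>

lemma good_imp_reduces_zeros:
  assumes "good d M" and "mset xs = M + replicate_mset k 0"
  shows "reduces (d, xs)"
  using assms
proof (induction arbitrary: xs k rule: good.induct)
  case good_base
  have "reduces (0, -1 # replicate k 0)"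
    by (simp add: reduces_def)
  then show ?case
    by (rule reduces_mset_cong[rotated]) (use good_base in simp)
next
  case (good_zero d M)
  show ?case
    by (rule good_zero.IH[of _ "Suc k"]) (use good_zero.prems in simp)
next
  case (good_move d a b c R)
  define rs where "rs = rev (sorted_list_of_multiset (R + replicate_mset k 0))"
  define ys where "ys = a # b # c # rs"
  have mrs: "mset rs = R + replicate_mset k 0"
    by (simp add: rs_def)
  have le: "x \<le> c" if "x \<in> set rs" for x
    using that good_move.hyps(4,5)
    by (auto simp: mrs simp flip: set_mset_mset split: if_splits)
  have srs: "sorted_wrt (\<ge>) rs"
    unfolding rs_def sorted_wrt_rev by (simp add: sorted_sorted_list_of_multiset)
  have sorted: "sorted_wrt (\<ge>) ys"
    using srs le good_move.hyps(2,3) by (force simp: ys_def)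
  define zs where "zs = [d - b - c, d - a - c, d - a - b] @ rs"
  have "reduces (2 * d - a - b - c, zs)"
    by (rule good_move.IH[of _ k]) (simp add: zs_def mrs)
  moreover have "crem_step (d, ys) (2 * d - a - b - c, zs)"
    using sorted by (simp add: crem_step_def cremona_def ys_def zs_def)
  moreover have "length zs = length ys"
    by (simp add: ys_def zs_def)
  ultimately have "reduces (d, ys)"
    by (simp add: reduces_def converse_rtranclp_into_rtranclp)
  then show ?case
    by (rule reduces_mset_cong[rotated]) (simp add: ys_def mrs good_move.prems)
qed

lemma good_imp_reduces: "good d (mset xs) \<Longrightarrow> reduces (d, xs)"
  by (rule good_imp_reduces_zeros[where k = 0]) auto

lemma good_zeros: "good d M \<Longrightarrow> good d (replicate_mset k 0 + M)"
  by (induction k) (auto intro: good_zero)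

text \<open>Form of \<open>good_move\<close> in which all shapes are free: matching the multisets
  and checking the linear identities become separate goals.\<close>

lemma good_step:
  assumes "good d' M'" and "M' = {#a', b', c'#} + R" and "M = {#a, b, c#} + R"
    and "d' = 2 * d - a - b - c" "a' = d - b - c" "b' = d - a - c" "c' = d - a - b"
    and "b \<le> a" "c \<le> b" "0 \<le> c" "\<forall>x \<in># R. x \<le> c"
  shows "good d M"
  using good_move[of d a b c R] assms by simp

text \<open>Four Cremona moves. All quantities are expressed through the smaller ones left over
  after the moves, which makes every comparison needed for the ordering immediate.\<close>

lemma good_block:
  fixes A B C C' E E' r s :: int
  assumes good: "good (B + C + C' + r) ({#C, C', r, r, r, r, r - s#} + R)"
    and ord: "0 \<le> s" "s \<le> r" "r \<le> C'" "C' \<le> C" "r \<le> B"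
    and R: "\<forall>x \<in># R. x \<le> B"
    and A: "A = 3 * B + 2 * C + 2 * C' - 3 * r + s"
    and E: "E = 2 * B + 2 * C + C' - 2 * r" "E' = 2 * B + C + 2 * C' - 2 * r"
  shows "good (A + E + E' + s) ({#A, A, A, A, A - B, E, E'#} + R)"
proof -
  \<comment> \<open>\<open>u\<close> and \<open>v\<close> are the entries that occur only between
    the moves. In order of reduction the moves take \<open>A, A, A\<close>, then
    \<open>A, A - B, E\<close>, then \<open>E', v, v\<close>, then \<open>v, u, u\<close>; thus
    \<open>g1\<close> undoes the last one. The leftovers \<open>r, r, r, r, r - s\<close> form a
    period again, with \<open>r\<close>, \<open>s\<close> in place of \<open>A\<close>,
    \<open>B\<close>.\<close>
  define u where "u = B + C'"
  define v where "v = B + C + C' - r"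
  note ball_mset_simps = set_mset_union set_mset_add_mset_insert set_mset_empty ball_Un ball_simps simp_thms
  have bound: "\<forall>x \<in># R. x \<le> t" if "B \<le> t" for t
    using R that by fastforce
  note eqs = u_def v_def A E
  have g1: "good (E' + 2 * r) ({#v, u, u, C', r, r, r - s#} + R)"
    by (rule good_step[OF good, where a=v and b=u and c=u and a'=C and b'=r and c'=r
          and R="{#C', r, r, r - s#} + R"], simp, simp)
      ((simp add: eqs algebra_simps; fail)+, unfold eqs, (use ord in linarith)+, simp only: ball_mset_simps,
       (intro conjI bound; use ord in linarith))
  have g2: "good (E' + r + v) ({#E', v, v, v, u, C', r - s#} + R)"
    by (rule good_step[OF g1, where a=E' and b=v and c=v and a'=u and b'=r and c'=r
          and R="{#v, u, C', r - s#} + R"], simp, simp)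
      ((simp add: eqs algebra_simps; fail)+, unfold eqs, (use ord in linarith)+, simp only: ball_mset_simps,
       (intro conjI bound; use ord in linarith))
  have g3: "good (E + E' + v + s) ({#A, A - B, E, E', v, v, v#} + R)"
    by (rule good_step[OF g2, where a=A and b="A - B" and c=E and a'=u and b'=C' and c'="r - s"
          and R="{#E', v, v, v#} + R"], simp, simp)
      ((simp add: eqs algebra_simps; fail)+, unfold eqs, (use ord in linarith)+, simp only: ball_mset_simps,
       (intro conjI bound; use ord in linarith))
  show ?thesis
    by (rule good_step[OF g3, where a=A and b=A and c=A and a'=v and b'=v and c'=v
          and R="{#A, A - B, E, E'#} + R"], simp, simp)
      ((simp add: eqs algebra_simps; fail)+, unfold eqs, (use ord in linarith)+, simp only: ball_mset_simps,
       (intro conjI bound; use ord in linarith))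
qed

section \<open>Balancing numbers and the final moves\<close>

fun bal :: "nat \<Rightarrow> int" where
  "bal 0 = 0"
| "bal (Suc 0) = 1"
| "bal (Suc (Suc m)) = 6 * bal (Suc m) - bal m"

lemma bal_growth: "0 \<le> bal m \<and> 5 * bal m \<le> bal (Suc m) \<and> 0 < bal (Suc m)"
  by (induction m) auto

lemma bal_nonneg [simp]: "0 \<le> bal m"
  and bal_Suc_ge: "5 * bal m \<le> bal (Suc m)"
  and bal_Suc_pos [simp]: "0 < bal (Suc m)"
  using bal_growth by blast+

text \<open>The form x^2 - 6xy + y^2 is invariant under (x, y) -> (6x - y, x). It yields the Pell
  equations and the Bezout identities used below.\<close>

lemma bal_norm: "bal (Suc m) ^ 2 - 6 * bal (Suc m) * bal m + bal m ^ 2 = 1"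
  by (induction m) (simp_all add: power2_eq_square algebra_simps)

lemma pell_hpell_bal:
  "pell (2 * m) = 2 * bal m"
  "pell (2 * m + 1) = bal (Suc m) - bal m"
  "hpell (2 * m) = bal (Suc m) - 3 * bal m"
  "hpell (2 * m + 1) = bal (Suc m) + bal m"
  by (induction m) auto

text \<open>The entries of \<open>euclid (bal (Suc m) - bal m) (bal m)\<close>, see
  \<open>mset_euclid_bal\<close>: the small end of the continued fraction of \<alpha>.\<close>

fun bal_blocks :: "nat \<Rightarrow> int multiset" where
  "bal_blocks 0 = {#}"
| "bal_blocks (Suc m) = {#bal (Suc m), bal (Suc m), bal (Suc m), bal (Suc m), bal (Suc m) - bal m#}
     + bal_blocks m"

lemma bal_blocks_le: "\<forall>x \<in># bal_blocks m. x \<le> bal m"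
proof (induction m)
  case (Suc m)
  have "bal m \<le> bal (Suc m)"
    using bal_Suc_ge[of m] bal_nonneg[of m] by linarith
  then show ?case
    using Suc by (force simp del: bal.simps)
qed simp

lemma good_base_110: "good 1 {#1, 1, 0#}"
proof -
  have "good 0 {#0, 0, -1#}"
    using good_zeros[OF good_base, of 2] by (simp add: numeral_2_eq_2 add_mset_commute)
  then show ?thesis
    by (rule good_step[where R = "{#}" and a = 1 and b = 1 and c = 0
          and a' = 0 and b' = 0 and c' = "-1"]) auto
qed

section \<open>Moves for the doubled tail and for the two centres\<close>

context
  fixes p q :: int and R :: "int multiset"
  assumes ord: "0 \<le> q" "2 * q \<le> p"
    and R: "\<forall>x \<in># R. x \<le> p - q"
begin

lemma final_bound: "\<forall>x \<in># R. x \<le> t" if "p - q \<le> t" for t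
  using R that by fastforce

lemmas ball_mset_simps =
  set_mset_union set_mset_add_mset_insert set_mset_empty ball_Un ball_simps simp_thms

text \<open>Here \<open>p\<close>, \<open>q\<close> stand for \<open>bal (Suc m)\<close>,
  \<open>bal m\<close>, and \<open>R\<close> for the rest of the tail. A tuple (d; d - x, x, x, ...)
  moves to (d - x; d - 2x, 0, 0, ...), so a pair of equal entries cancels. This is done with x =
  \<open>p\<close>, then with x = \<open>p - q\<close>.\<close>

lemma good_two_moves:
  assumes "good p ({#p - q, q#} + R)"
  shows "good (3 * p - q) ({#2 * p - q, p, p, p, p - q, p - q#} + R)"
proof -
  have g1: "good p ({#q, 0, 0, 0, 0, p - q#} + R)"
    using good_zeros[OF assms, of 4] by (simp add: numeral_eq_Suc add_mset_commute)
  have g2: "good (2 * p - q) ({#p - q, 0, 0, p, p - q, p - q#} + R)"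
    by (rule good_step[OF g1, where a = p and b = "p - q" and c = "p - q"
          and a' = q and b' = 0 and c' = 0 and R = "{#0, 0, p - q#} + R"], simp, simp)
      ((simp; fail)+, (use ord in linarith)+, simp only: ball_mset_simps,
       (intro conjI final_bound; use ord in linarith))
  show ?thesis
    by (rule good_step[OF g2, where a = "2 * p - q" and b = p and c = p
          and a' = "p - q" and b' = 0 and c' = 0 and R = "{#p, p - q, p - q#} + R"], simp, simp)
      ((simp; fail)+, (use ord in linarith)+, simp only: ball_mset_simps,
       (intro conjI final_bound; use ord in linarith))
qed

text \<open>Three pair cancellations with x = \<open>p\<close> use up six of the nine copies of
  \<open>p\<close>.\<close>

lemma good_three_moves:
  assumes "good (3 * p - q) ({#2 * p - q, p, p, p, p - q, p - q#} + R)"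
  shows "good (6 * p - q) ({#5 * p - q, p, p, p, p, p, p, p, p, p, p - q, p - q#} + R)"
proof -
  have g1: "good (3 * p - q) ({#2 * p - q, 0, 0, 0, 0, 0, 0, p, p, p, p - q, p - q#} + R)"
    using good_zeros[OF assms, of 6] by (simp add: numeral_eq_Suc add_mset_commute)
  have g2: "good (4 * p - q) ({#3 * p - q, 0, 0, 0, 0, p, p, p, p, p, p - q, p - q#} + R)"
    by (rule good_step[OF g1, where a = "3 * p - q" and b = p and c = p and a' = "2 * p - q"
          and b' = 0 and c' = 0 and R = "{#0, 0, 0, 0, p, p, p, p - q, p - q#} + R"], simp, simp)
      ((simp; fail)+, (use ord in linarith)+, simp only: ball_mset_simps,
       (intro conjI final_bound; use ord in linarith))
  have g3: "good (5 * p - q) ({#4 * p - q, 0, 0, p, p, p, p, p, p, p, p - q, p - q#} + R)"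
    by (rule good_step[OF g2, where a = "4 * p - q" and b = p and c = p and a' = "3 * p - q"
          and b' = 0 and c' = 0 and R = "{#0, 0, p, p, p, p, p, p - q, p - q#} + R"], simp, simp)
      ((simp; fail)+, (use ord in linarith)+, simp only: ball_mset_simps,
       (intro conjI final_bound; use ord in linarith))
  show ?thesis
    by (rule good_step[OF g3, where a = "5 * p - q" and b = p and c = p and a' = "4 * p - q"
          and b' = 0 and c' = 0 and R = "{#p, p, p, p, p, p, p, p - q, p - q#} + R"], simp, simp)
      ((simp; fail)+, (use ord in linarith)+, simp only: ball_mset_simps,
       (intro conjI final_bound; use ord in linarith))
qed

text \<open>The centre of \<alpha> for odd n. Three entries equal to half of the degree vanish
  together and halve the degree; a pair cancellation with x = \<open>p - q\<close> finishes.\<close>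

lemma good_odd_end:
  assumes "good p ({#p - q, q#} + R)"
  shows "good (4 * p - 2 * q)
    ({#2 * p - q, 2 * p - q, 2 * p - q, p, p - q, p - q, p - q#} + R)"
proof -
  have g1: "good p ({#q, 0, 0, 0, 0, 0, p - q#} + R)"
    using good_zeros[OF assms, of 5] by (simp add: numeral_eq_Suc add_mset_commute)
  have g2: "good (2 * p - q) ({#0, 0, 0, p, p - q, p - q, p - q#} + R)"
    by (rule good_step[OF g1, where a = p and b = "p - q" and c = "p - q"
          and a' = q and b' = 0 and c' = 0 and R = "{#0, 0, 0, p - q#} + R"], simp, simp)
      ((simp; fail)+, (use ord in linarith)+, simp only: ball_mset_simps,
       (intro conjI final_bound; use ord in linarith))
  show ?thesis
    by (rule good_step[OF g2, where a = "2 * p - q" and b = "2 * p - q" and c = "2 * p - q"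
          and a' = 0 and b' = 0 and c' = 0 and R = "{#p, p - q, p - q, p - q#} + R"], simp, simp)
      ((simp; fail)+, (use ord in linarith)+, simp only: ball_mset_simps,
       (intro conjI final_bound; use ord in linarith))
qed

text \<open>The centre of \<alpha> for even n > 0. The four moves end at the conclusion of
  \<open>good_two_moves\<close>, so six moves in all lead to the tuple of
  \<open>good_bal\<close>.\<close>

lemma good_even_end:
  assumes "good (3 * p - q) ({#2 * p - q, p, p, p, p - q, p - q#} + R)"
  shows "good (21 * p - 5 * q)
    ({#9 * p - 2 * q, 9 * p - 2 * q, 9 * p - 2 * q, 9 * p - 2 * q, 6 * p - 2 * q, 6 * p - 2 * q,
       5 * p - q, 4 * p - q, p, p, p, p - q#} + R)"
proof -
  have g1: "good (3 * p - q)
      ({#0, 0, 0, 2 * p - q, 0, 0, 0, p, p, p, p - q, p - q#} + R)"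
    using good_zeros[OF assms, of 6] by (simp add: numeral_eq_Suc add_mset_commute)
  have g2: "good (6 * p - 2 * q) ({#2 * p - q, p - q, 0, 0, 0,
      3 * p - q, 3 * p - q, 3 * p - q, p, p, p, p - q#} + R)"
    by (rule good_step[OF g1, where a = "3 * p - q" and b = "3 * p - q" and c = "3 * p - q"
          and a' = 0 and b' = 0 and c' = 0
          and R = "{#2 * p - q, 0, 0, 0, p, p, p, p - q, p - q#} + R"], simp, simp)
      ((simp; fail)+, (use ord in linarith)+, simp only: ball_mset_simps,
       (intro conjI final_bound; use ord in linarith))
  have g3: "good (9 * p - 2 * q) ({#3 * p, 0, 0, 5 * p - q, 4 * p - q,
      3 * p - q, 3 * p - q, 3 * p - q, p, p, p, p - q#} + R)"
    by (rule good_step[OF g2, where a = "5 * p - q" and b = "4 * p - q" and c = "3 * p"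
          and a' = "2 * p - q" and b' = "p - q" and c' = 0
          and R = "{#0, 0, 3 * p - q, 3 * p - q, 3 * p - q, p, p, p, p - q#} + R"], simp, simp)
      ((simp; fail)+, (use ord in linarith)+, simp only: ball_mset_simps,
       (intro conjI final_bound; use ord in linarith))
  have g4: "good (15 * p - 4 * q) ({#9 * p - 2 * q, 6 * p - 2 * q, 6 * p - 2 * q,
      5 * p - q, 4 * p - q, 3 * p - q, 3 * p - q, 3 * p - q, p, p, p, p - q#} + R)"
    by (rule good_step[OF g3, where a = "9 * p - 2 * q" and b = "6 * p - 2 * q"
          and c = "6 * p - 2 * q" and a' = "3 * p" and b' = 0 and c' = 0
          and R = "{#5 * p - q, 4 * p - q, 3 * p - q, 3 * p - q, 3 * p - q, p, p, p, p - q#} + R"],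
        simp, simp)
      ((simp; fail)+, (use ord in linarith)+, simp only: ball_mset_simps,
       (intro conjI final_bound; use ord in linarith))
  show ?thesis
    by (rule good_step[OF g4, where a = "9 * p - 2 * q" and b = "9 * p - 2 * q"
          and c = "9 * p - 2 * q" and a' = "3 * p - q" and b' = "3 * p - q" and c' = "3 * p - q"
          and R = "{#9 * p - 2 * q, 6 * p - 2 * q, 6 * p - 2 * q,
            5 * p - q, 4 * p - q, p, p, p, p - q#} + R"], simp, simp)
      ((simp; fail)+, (use ord in linarith)+, simp only: ball_mset_simps,
       (intro conjI final_bound; use ord in linarith))
qed

end

lemma bal_rest_le:
  "\<forall>x \<in># bal_blocks m + bal_blocks m + {#1#}. x \<le> bal (Suc m) - bal m"
proof -
  have "bal m \<le> bal (Suc m) - bal m" "1 \<le> bal (Suc m) - bal m"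
    using bal_Suc_ge[of m] bal_nonneg[of m] bal_Suc_pos[of m] by linarith+
  then show ?thesis
    using bal_blocks_le[of m] by fastforce
qed

lemma bal_Suc_ge2: "2 * bal m \<le> bal (Suc m)"
  using bal_Suc_ge[of m] bal_nonneg[of m] by linarith

text \<open>Doubling makes the entries cancel in pairs: two periods and the \<open>p\<close> in
  front contain \<open>p\<close> nine times and \<open>p - q\<close> twice, and five pair
  cancellations lead to the same tuple one index lower.\<close>

lemma good_bal:
  "good (bal (Suc m))
     ({#bal (Suc m) - bal m, bal m#} + (bal_blocks m + bal_blocks m + {#1#}))"
proof (induction m)
  case 0
  then show ?case
    using good_base_110 by (simp add: add_mset_commute)
next
  case (Suc m)
  have "good (6 * bal (Suc m) - bal m)
    ({#5 * bal (Suc m) - bal m, bal (Suc m), bal (Suc m), bal (Suc m), bal (Suc m), bal (Suc m),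
       bal (Suc m), bal (Suc m), bal (Suc m), bal (Suc m), bal (Suc m) - bal m,
       bal (Suc m) - bal m#} + (bal_blocks m + bal_blocks m + {#1#}))"
    by (rule good_three_moves good_two_moves bal_nonneg bal_Suc_ge2 bal_rest_le Suc.IH)+
  \<comment> \<open>The nine copies of \<open>p\<close> are split as one, four and four. The term
    \<open>6 * p - q - p\<close> stays unsimplified because \<open>bal.simps\<close> unfolds the
    goal to this form.\<close>
  moreover have "{#5 * p - q, p, p, p, p, p, p, p, p, p, p - q, p - q#} + (S + S + {#1#})
      = {#6 * p - q - p, p#}
        + (({#p, p, p, p, p - q#} + S) + ({#p, p, p, p, p - q#} + S) + {#1#})"
    for p q :: int and S
    by simp
  ultimately show ?case
    by (simp only: bal.simps bal_blocks.simps)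
qed

section \<open>The Euclidean algorithm and weight expansions\<close>

text \<open>The sides of the squares cut greedily from a \<open>p\<close> by \<open>q\<close>
  rectangle. For coprime \<open>p\<close>, \<open>q\<close> with \<open>q\<close> positive they are
  \<open>q\<close> times the weights of p/q.\<close>

function euclid :: "int \<Rightarrow> int \<Rightarrow> int list" where
  "euclid p q = (if q \<le> 0 then [] else replicate (nat (p div q)) q @ euclid q (p mod q))"
  by pat_completeness auto
termination by (relation "measure (\<lambda>(p, q). nat q)") auto

declare euclid.simps [simp del]

lemma euclid_0 [simp]: "euclid p 0 = []"
  by (simp add: euclid.simps)

lemma set_euclid: "x \<in> set (euclid p q) \<Longrightarrow> 0 < x \<and> x \<le> q"
proof (induction p q rule: euclid.induct)
  case (1 p q)
  show ?case
  proof (cases "q \<le> 0")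
    case False
    have "p mod q \<le> q"
      using False by (simp add: order_less_imp_le)
    then show ?thesis
      using 1 False by (subst (asm) euclid.simps) (force split: if_splits)
  qed (use 1 in \<open>simp add: euclid.simps\<close>)
qed

lemma sorted_wrt_replicate: "R x x \<Longrightarrow> sorted_wrt R (replicate n x)"
  by (induction n) auto

lemma sorted_euclid: "sorted_wrt (\<ge>) (euclid p q)"
proof (induction p q rule: euclid.induct)
  case (1 p q)
  show ?case
  proof (cases "q \<le> 0")
    case False
    have "p mod q \<le> q"
      using False by (simp add: order_less_imp_le)
    then show ?thesis
      using 1 False set_euclid[of _ q "p mod q"]
      by (subst euclid.simps) (auto simp: sorted_wrt_append sorted_wrt_replicate intro: order_trans)
  qed (simp add: euclid.simps)
qed

lemma sum_list_euclid:
  "0 \<le> p \<Longrightarrow> 0 \<le> q \<Longrightarrow> sum_list (euclid p q) = p + q - gcd p q"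
proof (induction p q rule: euclid.induct)
  case (1 p q)
  show ?case
  proof (cases "q \<le> 0")
    case False
    have "sum_list (euclid p q) = p div q * q + (q + p mod q - gcd q (p mod q))"
      using 1 False by (subst euclid.simps) (simp add: sum_list_replicate pos_imp_zdiv_nonneg_iff)
    also have "\<dots> = p + q - gcd p q"
      using div_mult_mod_eq[of p q] by (simp add: gcd_red_int[of p q])
    finally show ?thesis .
  qed (use 1 in \<open>simp add: euclid.simps\<close>)
qed

text \<open>The squares tile the rectangle, so their areas add up to its area.\<close>

lemma sum_list_squares_euclid:
  "0 \<le> p \<Longrightarrow> 0 \<le> q \<Longrightarrow> sum_list (map (\<lambda>x. x ^ 2) (euclid p q)) = p * q"
proof (induction p q rule: euclid.induct)
  case (1 p q)
  show ?case
  proof (cases "q \<le> 0")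
    case False
    have "sum_list (map (\<lambda>x. x ^ 2) (euclid p q)) = p div q * q ^ 2 + q * (p mod q)"
      using 1 False by (subst euclid.simps) (simp add: sum_list_replicate pos_imp_zdiv_nonneg_iff)
    also have "\<dots> = (p div q * q + p mod q) * q"
      by (simp only: power2_eq_square distrib_right mult.assoc mult.commute[of q "p mod q"])
    also have "\<dots> = p * q"
      by (simp only: div_mult_mod_eq)
    finally show ?thesis .
  qed (use 1 in \<open>simp add: euclid.simps\<close>)
qed

section \<open>Euclidean steps on symbolic arguments\<close>

lemma euclid_add:
  assumes "0 < q" "0 \<le> p"
  shows "euclid (int l * q + p) q = replicate l q @ euclid p q"
proof -
  have "nat (int l + p div q) = l + nat (p div q)"
    using assms by (simp add: nat_add_distrib pos_imp_zdiv_nonneg_iff)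
  then show ?thesis
    using assms by (simp add: euclid.simps[of "int l * q + p"] euclid.simps[of p] replicate_add)
qed

text \<open>If \<open>p < q\<close>, the first quotient is 0 and the step merely exchanges the
  arguments. Together with \<open>euclid_Cons\<close> this avoids evaluating \<open>div\<close> and
  \<open>mod\<close>.\<close>

lemma euclid_swap:
  assumes "0 \<le> p" "p \<le> q"
  shows "euclid p q = euclid q p"
  using assms by (cases "p = q") (simp_all add: euclid.simps[of p q])

lemma euclid_Cons:
  assumes "0 < q" "q \<le> p"
  shows "euclid p q = q # euclid (p - q) q"
  using euclid_add[of q "p - q" 1] assms by simp

text \<open>One period 4, 1 of the quotients. The remaining pair has the shape (5A' - B', A') again,
  with A' = \<open>B\<close> and B' = \<open>6 * B - A\<close>.\<close>

lemma euclid_block: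
  assumes "0 \<le> B" "2 * B < A"
  shows "euclid (5 * A - B) A = [A, A, A, A, A - B] @ euclid (A - B) B"
proof -
  have "euclid (5 * A - B) A = replicate 4 A @ euclid (A - B) A"
    using euclid_add[of A "A - B" 4] assms by simp
  also have "euclid (A - B) A = euclid A (A - B)"
    by (rule euclid_swap) (use assms in auto)
  also have "\<dots> = (A - B) # euclid B (A - B)"
    using euclid_Cons[of "A - B" A] assms by simp
  also have "euclid B (A - B) = euclid (A - B) B"
    by (rule euclid_swap) (use assms in auto)
  finally show ?thesis
    by (simp add: numeral_eq_Suc)
qed

text \<open>The Euclidean recursion with prescribed quotients. It is homogeneous in the starting
  pair, so multiplication by the denominator only turns the start (a, 1) of the weight expansion
  into (p, q).\<close>

fun euclid_along :: "nat list \<Rightarrow> rat \<Rightarrow> rat \<Rightarrow> rat list" where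
  "euclid_along [] s t = []"
| "euclid_along (l # ls) s t = replicate l t @ euclid_along ls t (s - of_nat l * t)"

lemma map_mult_euclid_along:
  "map (\<lambda>x. c * x) (euclid_along ls s t) = euclid_along ls (c * s) (c * t)"
  by (induction ls arbitrary: s t) (simp_all add: algebra_simps)

text \<open>\<open>s\<close> acts as the entry of index -1. With \<open>x\<close>, \<open>s\<close>,
  \<open>t\<close> arbitrary, the tail of the list is an instance with \<open>x\<close> shifted by
  one.\<close>

lemma concat_eq_euclid_along:
  assumes "x 0 = t" "ls \<noteq> [] \<Longrightarrow> x 1 = s - of_nat (ls ! 0) * t"
    and "\<And>i. Suc i < length ls \<Longrightarrow> x (Suc (Suc i)) = x i - of_nat (ls ! Suc i) * x (Suc i)"
  shows "concat (map (\<lambda>i. replicate (ls ! i) (x i)) [0..<length ls]) = euclid_along ls s t"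
  using assms
proof (induction ls arbitrary: x s t)
  case (Cons l ls)
  have "concat (map (\<lambda>i. replicate (ls ! i) (x (Suc i))) [0..<length ls])
      = euclid_along ls t (s - of_nat l * t)"
  proof (rule Cons.IH)
    show "x (Suc 1) = t - of_nat (ls ! 0) * (s - of_nat l * t)" if "ls \<noteq> []"
      using that Cons.prems(1,2) Cons.prems(3)[of 0] by simp
    show "x (Suc (Suc (Suc i))) = x (Suc i) - of_nat (ls ! Suc i) * x (Suc (Suc i))"
      if "Suc i < length ls" for i
      using that Cons.prems(3)[of "Suc i"] by simp
  qed (use Cons.prems(2) in simp)
  moreover have "[0..<length (l # ls)] = 0 # map Suc [0..<length ls]"
    by (simp add: upt_conv_Cons map_Suc_upt del: upt_Suc)
  ultimately show ?case
    using Cons.prems(1) by (simp add: comp_def del: upt_Suc)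
qed simp

declare cf_nat.simps [simp del]

lemma euclid_along_cf_nat:
  "euclid_along (cf_nat p q) (of_nat p) (of_nat q) = map of_int (euclid (int p) (int q))"
proof (induction p q rule: cf_nat.induct)
  case (1 p q)
  show ?case
  proof (cases "q = 0")
    case False
    have "of_nat p - of_nat (p div q) * of_nat q = (of_nat (p mod q) :: rat)"
      by (metis add_diff_cancel_left' div_mult_mod_eq of_nat_add of_nat_mult)
    moreover have "nat (int p div int q) = p div q" "int p mod int q = int (p mod q)"
      by (simp_all add: nat_div_distrib zmod_int)
    ultimately show ?thesis
      using 1 False by (simp add: cf_nat.simps[of p q] euclid.simps[of "int p" "int q"])
  qed (simp add: cf_nat.simps)
qed

lemma denom_mult_weight:
  assumes "quotient_of a = (p, q)" "0 \<le> p"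
  shows "map (\<lambda>x. of_int (denom a) * x) (weight a) = map of_int (euclid p q)"
proof -
  have q: "0 < q"
    using assms(1) by (rule quotient_of_denom_pos)
  have a: "a = of_int p / of_int q"
    using assms(1) by (rule quotient_of_div)
  have "weight a = euclid_along (cf a) a 1"
    unfolding weight_def Let_def by (rule concat_eq_euclid_along) simp_all
  then have "map (\<lambda>x. of_int (denom a) * x) (weight a)
      = euclid_along (cf_nat (nat p) (nat q)) (of_nat (nat p)) (of_nat (nat q))"
    using assms q by (simp add: map_mult_euclid_along denom_def cf_def a)
  then show ?thesis
    using assms q by (simp only: euclid_along_cf_nat) simp
qed

lemma quotient_of_divide:
  assumes "coprime p q" "0 < q"
  shows "quotient_of (of_int p / of_int q) = (p, q)"
  using assms by (simp add: quotient_of_Fract normalize_stable flip: Fract_of_int_quotient)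

section \<open>Families of good tuples\<close>

text \<open>\<open>euclid_block\<close> exposes the period that \<open>good_block\<close> removes,
  while \<open>T\<close> collects entries of the tail that do not move. For \<open>r = 0\<close> the
  moves leave only zeros behind.\<close>

lemma good_euclid_step:
  fixes A B C C' E E' r s :: int
  assumes good: "good (B + C + C' + r)
      ({#C, C'#} + mset (euclid (A - B) B) + ({#r, r, r, r, r - s#} + T))"
    and ord: "0 \<le> s" "s \<le> r" "r \<le> C'" "C' \<le> C" "r \<le> B" "0 < B"
    and T: "\<forall>x \<in># T. x \<le> B"
    and A: "A = 3 * B + 2 * C + 2 * C' - 3 * r + s"
    and E: "E = 2 * B + 2 * C + C' - 2 * r" "E' = 2 * B + C + 2 * C' - 2 * r"
  shows "good (A + E + E' + s) ({#E, E'#} + mset (euclid (5 * A - B) A) + T)"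
proof -
  have "2 * B < A"
    using A ord by linarith
  then have "euclid (5 * A - B) A = [A, A, A, A, A - B] @ euclid (A - B) B"
    using ord by (intro euclid_block) auto
  moreover have "good (A + E + E' + s)
      ({#A, A, A, A, A - B, E, E'#} + (mset (euclid (A - B) B) + T))"
    using good T by (intro good_block[OF _ ord(1-5) _ A E])
      (auto simp: add_mset_commute dest: set_euclid)
  ultimately show ?thesis
    by simp
qed

section \<open>Pell recurrences and the descent for \<beta>\<close>

lemma pell_Suc: "pell (Suc n) = hpell n + pell n"
  and hpell_Suc: "hpell (Suc n) = hpell n + 2 * pell n"
  by (induction n rule: pell.induct) auto

lemma pell_hpell_Suc_Suc:
  "pell (Suc (Suc n)) = 2 * hpell n + 3 * pell n"
  "hpell (Suc (Suc n)) = 3 * hpell n + 4 * pell n"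
  by (simp_all add: pell_Suc hpell_Suc del: pell.simps(3) hpell.simps(3))

declare pell.simps(3) [simp del] hpell.simps(3) [simp del]

lemma pell_nonneg: "0 \<le> pell n"
  and hpell_pos: "1 \<le> hpell n"
  by (induction n rule: pell.induct) (simp_all add: pell.simps(3) hpell.simps(3))

text \<open>This is E(\<beta>_n), n = 2k, after its largest entry H_n has been split off. A period
  with \<open>r = 0\<close> lowers n by two.\<close>

lemma good_hpell_even:
  "good (hpell (2 * k) + 2 * pell (2 * k))
    ({#pell (2 * k), pell (2 * k)#}
      + mset (euclid (2 * hpell (2 * k) + 4 * pell (2 * k)) (hpell (2 * k))))"
proof (induction k)
  case 0
  have "good 1 {#0, 1, 1, 0#}"
    by (rule good_zero) (rule good_base_110)
  then show ?case
    by (simp add: euclid.simps numeral_2_eq_2 add_mset_commute)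
next
  case (Suc k)
  define B where "B = hpell (2 * k)"
  define C where "C = pell (2 * k)"
  have "good (B + C + C) ({#C, C#} + mset (euclid (2 * B + 4 * C) B))"
    using Suc by (simp add: B_def C_def algebra_simps)
  then have "good (B + C + C) ({#C, C#} + mset (euclid (2 * B + 4 * C) B) + {#0, 0, 0, 0, 0#})"
    using good_zeros[of _ _ 5] by (simp add: numeral_eq_Suc)
  then have "good ((3 * B + 4 * C) + (2 * B + 3 * C) + (2 * B + 3 * C) + 0)
    ({#2 * B + 3 * C, 2 * B + 3 * C#}
      + mset (euclid (5 * (3 * B + 4 * C) - B) (3 * B + 4 * C)) + {#})"
    by (intro good_euclid_step[where C = C and C' = C and r = 0])
      (use pell_nonneg[of "2 * k"] hpell_pos[of "2 * k"] in \<open>simp_all add: B_def C_def\<close>)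
  then show ?case
    by (simp add: pell_hpell_Suc_Suc B_def C_def algebra_simps)
qed

text \<open>For odd n the odd number H_n is divided into the unequal entries \<open>g + 1\<close>
  and \<open>g\<close>; hence the distinct \<open>C\<close> and \<open>C'\<close> in
  \<open>good_block\<close>.\<close>

lemma good_pell_odd:
  "hpell (2 * k + 1) = 2 * g + 1 \<Longrightarrow>
   good (pell (2 * k + 1) + 2 * g + 1)
    ({#g + 1, g#} + mset (euclid (2 * pell (2 * k + 1) + 4 * g + 2) (pell (2 * k + 1))))"
proof (induction k arbitrary: g)
  case 0
  have "good 1 ({#0, 0, 0#} + {#1, 1, 0#})"
    using good_zeros[OF good_base_110, of 3] by (simp add: numeral_eq_Suc)
  then have "good 2 {#1, 1, 1, 1, 1, 0#}"
    by (rule good_step[where a = 1 and b = 1 and c = 1 and a' = 0 and b' = 0 and c' = 0]) auto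
  then show ?case
    using 0 by (simp add: euclid.simps numeral_eq_Suc add_mset_commute)
next
  case (Suc k)
  define B where "B = pell (2 * k + 1)"
  have H: "hpell (2 * Suc k + 1) = 3 * hpell (2 * k + 1) + 4 * B"
    and P: "pell (2 * Suc k + 1) = 2 * hpell (2 * k + 1) + 3 * B"
    by (simp_all add: pell_hpell_Suc_Suc B_def)
  \<comment> \<open>Solves \<open>2 * g + 1 = 3 * (2 * h + 1) + 4 * B\<close> for the previous index
    without a division.\<close>
  define h where "h = g - hpell (2 * k + 1) - 2 * B"
  have h: "hpell (2 * k + 1) = 2 * h + 1"
    using Suc.prems H by (simp add: h_def)
  then have g: "g = 2 * B + 3 * h + 1"
    by (simp add: h_def)
  have P': "pell (2 * Suc k + 1) = 3 * B + 4 * h + 2"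
    using P h by simp
  have "good (B + 2 * h + 1) ({#h + 1, h#} + mset (euclid (2 * B + 4 * h + 2) B))"
    using Suc.IH[OF h] by (simp add: B_def)
  then have "good (B + (h + 1) + h)
      ({#h + 1, h#} + mset (euclid (2 * B + 4 * h + 2) B) + {#0, 0, 0, 0, 0#})"
    using good_zeros[of _ _ 5] by (simp add: numeral_eq_Suc algebra_simps add_mset_commute)
  then have "good ((3 * B + 4 * h + 2) + (g + 1) + g + 0)
    ({#g + 1, g#} + mset (euclid (5 * (3 * B + 4 * h + 2) - B) (3 * B + 4 * h + 2)) + {#})"
    by (intro good_euclid_step[where C = "h + 1" and C' = h and r = 0])
      (use pell_nonneg[of "2 * k"] hpell_pos[of "2 * k"] hpell_pos[of "2 * k + 1"] h
        in \<open>simp_all add: B_def g algebra_simps pell_Suc\<close>)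
  then show ?case
    unfolding P' by (simp add: g algebra_simps)
qed

lemma mono_bal: "mono bal"
  unfolding mono_iff_le_Suc
proof
  show "bal m \<le> bal (Suc m)" for m
    using bal_Suc_ge[of m] bal_nonneg[of m] by linarith
qed

text \<open>For \<open>\<alpha>\<close> the leading weights are \<open>c * f k + bal i\<close> with \<open>i + k\<close> fixed: \<open>k\<close> counts the periods
  up to the centre of the continued fraction and \<open>i\<close> those removed so far.\<close>

lemma good_bal_product:
  fixes f g :: "nat \<Rightarrow> int" and c :: int
  assumes rec: "\<And>k. f (Suc k) = 3 * f k + 4 * g k" "\<And>k. g (Suc k) = 2 * f k + 3 * g k"
    and pos: "\<And>k. 1 \<le> f k" "\<And>k. 1 \<le> g k" "0 < c" "bal m \<le> c"
    and base: "good (c * f 0 + 2 * c * g 0 + 2 * bal m) ({#c * g 0, c * g 0#}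
      + mset (euclid (c * (2 * f 0 + 4 * g 0) + 5 * bal m - bal (Suc m)) (c * f 0 + bal m))
      + (bal_blocks m + {#1#}))"
  shows "i + k = m \<Longrightarrow> good (c * f k + 2 * c * g k + 2 * bal i) ({#c * g k, c * g k#}
      + mset (euclid (c * (2 * f k + 4 * g k) + 5 * bal i - bal (Suc i)) (c * f k + bal i))
      + (bal_blocks i + {#1#}))"
proof (induction k arbitrary: i)
  case 0
  then show ?case
    using base by simp
next
  case (Suc k)
  define r where "r = bal (Suc i)"
  define s where "s = bal i"
  define F where "F = c * f k"
  define C where "C = c * g k"
  \<comment> \<open>Here \<open>Suc i \<le> m\<close>, so \<open>r \<le> bal m \<le> c\<close>. This
    gives \<open>r \<le> C\<close>, the comparison that the moves need.\<close>
  have "r \<le> c"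
    using monoD[OF mono_bal, of "Suc i" m] Suc.prems pos(4) by (simp add: r_def)
  moreover have "c * 1 \<le> F" "c * 1 \<le> C"
    unfolding F_def C_def by (intro mult_left_mono; use pos in simp)+
  ultimately have ord: "0 \<le> s" "s \<le> r" "r \<le> C" "0 < F" "0 < r"
    using monoD[OF mono_bal, of i "Suc i"] pos(3) by (simp_all add: r_def s_def)
  have T: "\<forall>x \<in># bal_blocks i + {#1#}. x \<le> F + r"
    using bal_blocks_le[of i] ord by (force simp: s_def)
  have "good (F + 2 * C + 2 * r) ({#C, C#}
      + mset (euclid (c * (2 * f k + 4 * g k) + 5 * r - bal (Suc (Suc i))) (F + r))
      + (bal_blocks (Suc i) + {#1#}))"
    using Suc.IH[of "Suc i"] Suc.prems
    by (simp add: F_def C_def r_def mult.assoc del: bal.simps bal_blocks.simps)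
  also have "c * (2 * f k + 4 * g k) + 5 * r - bal (Suc (Suc i))
      = (3 * F + 4 * C + s) - (F + r)"
    by (simp add: F_def C_def r_def s_def algebra_simps)
  \<comment> \<open>\<open>bal_blocks (Suc i)\<close> is split into \<open>r, r, r, r, r - s\<close>
    and \<open>bal_blocks i\<close>; the first part is exactly what the four moves leave
    behind.\<close>
  finally have "good ((F + r) + C + C + r)
      ({#C, C#} + mset (euclid ((3 * F + 4 * C + s) - (F + r)) (F + r))
        + ({#r, r, r, r, r - s#} + (bal_blocks i + {#1#})))"
    by (simp add: r_def s_def algebra_simps add_mset_commute)
  then have "good ((3 * F + 4 * C + s) + (2 * F + 3 * C) + (2 * F + 3 * C) + s)
      ({#2 * F + 3 * C, 2 * F + 3 * C#}
        + mset (euclid (5 * (3 * F + 4 * C + s) - (F + r)) (3 * F + 4 * C + s))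
        + (bal_blocks i + {#1#}))"
    by (rule good_euclid_step) (use ord T in simp_all)
  then show ?case
    by (simp add: rec r_def s_def F_def C_def algebra_simps)
qed

section \<open>The classes\<close>

text \<open>Since the gcd is 1, the sides add up to \<open>p + q - 1\<close> and the areas to
  \<open>p * q\<close>, which are the linear and quadratic conditions of
  \<open>ECal\<close>.\<close>

lemma ECal_euclid:
  assumes "0 < q" "q \<le> p" "coprime p q" "0 \<le> d" "0 \<le> e" "p + q = 2 * (d + e)" "p * q = 2 * d * e + 1"
    and "good (d + e - q) ({#d - q, e - q#} + mset (euclid (p - q) q))"
  shows "(d, e, euclid p q) \<in> ECal"
proof -
  have Cons: "euclid p q = q # euclid (p - q) q"
    using assms(1,2) by (rule euclid_Cons)
  have "last (euclid p q) \<in> set (euclid p q)"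
    by (rule last_in_set) (simp add: Cons)
  then have "0 \<le> last (euclid p q)"
    by (auto dest: set_euclid)
  moreover have "reduces (d + e - q, [d - q, e - q] @ euclid (p - q) q)"
    using assms(8) by (intro good_imp_reduces) simp
  ultimately show ?thesis
    using assms sorted_euclid[of p q] sum_list_euclid[of p q] sum_list_squares_euclid[of p q]
    by (simp add: ECal_def Cons coprime_iff_gcd_eq_1)
qed

text \<open>The appended 1 raises both sums by one, which accounts for the different right-hand
  sides for \<alpha>.\<close>

lemma ECal_euclid_append:
  assumes "0 < q" "q \<le> p" "coprime p q" "0 \<le> d" "p + q = 4 * d - 1" "p * q = 2 * d\<^sup>2"
    and "good (2 * d - q) ({#d - q, d - q#} + mset (euclid (p - q) q) + {#1#})"
  shows "(d, d, euclid p q @ [1]) \<in> ECal"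
proof -
  have Cons: "euclid p q = q # euclid (p - q) q"
    using assms(1,2) by (rule euclid_Cons)
  have "sorted_wrt (\<ge>) (euclid p q @ [1])"
    using sorted_euclid[of p q] set_euclid[of _ p q] by (force simp: sorted_wrt_append)
  moreover have "reduces (2 * d - q, [d - q, d - q] @ euclid (p - q) q @ [1])"
    using assms(7) by (intro good_imp_reduces) (simp add: add_mset_commute)
  ultimately show ?thesis
    using assms sum_list_euclid[of p q] sum_list_squares_euclid[of p q]
    by (simp add: ECal_def Cons coprime_iff_gcd_eq_1 power2_eq_square)
qed

lemma denom_mult_weight_divide:
  assumes "coprime p q" "0 < q" "0 \<le> p"
  shows "map (\<lambda>x. of_int (denom (of_int p / of_int q)) * x) (weight (of_int p / of_int q))
    = map of_int (euclid p q)"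
  using assms by (intro denom_mult_weight quotient_of_divide) auto

lemma coprimeI_bezout: "a * x + b * y = 1 \<Longrightarrow> coprime x y" for a b x y :: int
  by (rule coprimeI) (metis dvd_add dvd_mult)

text \<open>The hypothesis says \<open>(4 * P - h) * h - 2 * P^2 = 1\<close>, a Bezout identity. It
  covers both parities of \<alpha>.\<close>

lemma coprime_squares:
  fixes h P :: int
  assumes "h\<^sup>2 + 2 * P\<^sup>2 + 1 = 4 * P * h"
  shows "coprime (h\<^sup>2) (2 * P\<^sup>2)"
proof -
  have "(4 * P - h) * h + (- 1) * (2 * P\<^sup>2) = 1"
    using assms by (simp add: power2_eq_square algebra_simps)
  then have "coprime h (2 * P\<^sup>2)"
    by (rule coprimeI_bezout)
  then show ?thesis
    by simp
qed

lemma mset_euclid_bal: "mset (euclid (bal (Suc m) - bal m) (bal m)) = bal_blocks m"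
proof (induction m)
  case (Suc m)
  have "2 * bal m < bal (Suc m)"
    using bal_Suc_ge[of m] bal_nonneg[of m] bal_Suc_pos[of m] by linarith
  then have "euclid (5 * bal (Suc m) - bal m) (bal (Suc m))
      = [bal (Suc m), bal (Suc m), bal (Suc m), bal (Suc m), bal (Suc m) - bal m]
        @ euclid (bal (Suc m) - bal m) (bal m)"
    by (intro euclid_block) auto
  moreover have "bal (Suc (Suc m)) - bal (Suc m) = 5 * bal (Suc m) - bal m"
    by simp
  ultimately show ?case
    using Suc by simp
qed simp

section \<open>The Euclidean algorithm at the centre\<close>

context
  fixes p q :: int
  assumes ord: "0 \<le> q" "2 * q < p"
begin

lemma euclid_diff_swap: "euclid (p - q) p = (p - q) # euclid (p - q) q"
proof -
  have "euclid (p - q) p = euclid p (p - q)"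
    by (rule euclid_swap) (use ord in auto)
  also have "\<dots> = (p - q) # euclid q (p - q)"
    using euclid_Cons[of "p - q" p] ord by simp
  also have "euclid q (p - q) = euclid (p - q) q"
    by (rule euclid_swap) (use ord in auto)
  finally show ?thesis .
qed

text \<open>For \<open>q > 0\<close> the quotients at this centre are 3, 1, 1, followed by the
  balancing tail.\<close>

lemma euclid_odd_end:
  "euclid (7 * p - 3 * q) (2 * p - q)
    = [2 * p - q, 2 * p - q, 2 * p - q, p, p - q] @ euclid (p - q) q"
proof -
  have "euclid (7 * p - 3 * q) (2 * p - q) = replicate 3 (2 * p - q) @ euclid p (2 * p - q)"
    using euclid_add[of "2 * p - q" p 3] ord by simp
  also have "euclid p (2 * p - q) = euclid (2 * p - q) p"
    by (rule euclid_swap) (use ord in auto)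
  also have "\<dots> = p # euclid (p - q) p"
    using euclid_Cons[of p "2 * p - q"] ord by simp
  finally show ?thesis
    by (simp add: euclid_diff_swap numeral_3_eq_3)
qed

text \<open>For \<open>q > 0\<close> the quotients are 4, 1, 1, 3, 1, followed by the balancing
  tail.\<close>

lemma euclid_even_end:
  "euclid (41 * p - 9 * q) (9 * p - 2 * q)
    = [9 * p - 2 * q, 9 * p - 2 * q, 9 * p - 2 * q, 9 * p - 2 * q, 5 * p - q, 4 * p - q, p, p, p,
       p - q] @ euclid (p - q) q"
proof -
  have "euclid (41 * p - 9 * q) (9 * p - 2 * q)
      = replicate 4 (9 * p - 2 * q) @ euclid (5 * p - q) (9 * p - 2 * q)"
    using euclid_add[of "9 * p - 2 * q" "5 * p - q" 4] ord by simp
  also have "euclid (5 * p - q) (9 * p - 2 * q) = euclid (9 * p - 2 * q) (5 * p - q)"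
    by (rule euclid_swap) (use ord in auto)
  also have "\<dots> = (5 * p - q) # euclid (4 * p - q) (5 * p - q)"
    using euclid_Cons[of "5 * p - q" "9 * p - 2 * q"] ord by simp
  also have "euclid (4 * p - q) (5 * p - q) = euclid (5 * p - q) (4 * p - q)"
    by (rule euclid_swap) (use ord in auto)
  also have "\<dots> = (4 * p - q) # euclid p (4 * p - q)"
    using euclid_Cons[of "4 * p - q" "5 * p - q"] ord by simp
  also have "euclid p (4 * p - q) = euclid (4 * p - q) p"
    by (rule euclid_swap) (use ord in auto)
  also have "\<dots> = replicate 3 p @ euclid (p - q) p"
    using euclid_add[of p "p - q" 3] ord by simp
  finally show ?thesis
    by (simp add: euclid_diff_swap numeral_eq_Suc)
qed

end

lemma pell_Suc_pos: "1 \<le> pell (Suc n)"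
  using pell_nonneg[of n] hpell_pos[of n] by (simp add: pell_Suc)

lemma bal_Suc_gt: "2 * bal m < bal (Suc m)"
  using bal_Suc_ge[of m] bal_nonneg[of m] bal_Suc_pos[of m] by linarith

section \<open>The classes E(\<beta>_n)\<close>

lemma E_beta_even: "E_beta (2 * k) \<in> rat_of_class ` ECal"
proof -
  define f where "f = hpell (2 * k)"
  define g where "g = pell (2 * k)"
  have H: "hpell (2 * k + 2) = 3 * f + 4 * g"
    by (simp add: pell_hpell_Suc_Suc f_def g_def)
  have f: "f = bal (Suc k) - 3 * bal k" and g: "g = 2 * bal k"
    by (simp_all add: f_def g_def pell_hpell_bal)
  have norm: "f\<^sup>2 = 2 * g\<^sup>2 + 1"
    using bal_norm[of k] by (simp add: f g power2_eq_square algebra_simps)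
  have pos: "1 \<le> f" "0 \<le> g"
    by (simp_all add: f_def g_def hpell_pos pell_nonneg)
  \<comment> \<open>As \<open>g = 2 * bal k\<close>, the left side equals f^2 - 2g^2.\<close>
  have "(f + 3 * bal k) * f + - bal k * (3 * f + 4 * g) = 1"
    using norm by (simp add: g power2_eq_square algebra_simps)
  then have "coprime f (3 * f + 4 * g)"
    by (rule coprimeI_bezout)
  then have cop: "coprime (3 * f + 4 * g) f"
    by (simp add: coprime_commute)
  have "(f + g, f + g, euclid (3 * f + 4 * g) f) \<in> ECal"
  proof (rule ECal_euclid[OF _ _ cop])
    show "(3 * f + 4 * g) * f = 2 * (f + g) * (f + g) + 1"
      using norm by (simp add: power2_eq_square algebra_simps)
    show "good (f + g + (f + g) - f)
        ({#f + g - f, f + g - f#} + mset (euclid (3 * f + 4 * g - f) f))"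
      using good_hpell_even[of k] by (simp add: f_def g_def algebra_simps)
  qed (use pos in simp_all)
  moreover have "E_beta (2 * k) = rat_of_class (f + g, f + g, euclid (3 * f + 4 * g) f)"
    using denom_mult_weight_divide[OF cop] pos H
    by (simp add: E_beta_def rat_of_class_def W_def beta_def flip: f_def)
  ultimately show ?thesis
    by blast
qed

lemma odd_hpell: "odd (hpell n)"
  by (induction n) (simp_all add: hpell_Suc)

lemma E_beta_odd: "E_beta (2 * k + 1) \<in> rat_of_class ` ECal"
proof -
  define x where "x = pell (2 * k + 1)"
  have x: "x = bal (Suc k) - bal k" and hb: "hpell (2 * k + 1) = bal (Suc k) + bal k"
    using pell_hpell_bal(2,4)[of k] by (simp_all add: x_def)
  obtain g where h: "hpell (2 * k + 1) = 2 * g + 1"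
    using odd_hpell by (rule oddE)
  have X: "pell (Suc (2 * k)) = x"
    by (simp add: x_def)
  have P: "pell (Suc (Suc (Suc (2 * k)))) = 3 * x + 4 * g + 2"
    using h by (simp add: pell_hpell_Suc_Suc x_def)
  have norm: "2 * x\<^sup>2 = (2 * g + 1)\<^sup>2 + 1"
    using bal_norm[of k] unfolding h[symmetric] x hb
    by (simp add: power2_eq_square algebra_simps)
  have pos: "1 \<le> x" "0 \<le> g"
    using h hpell_pos[of "2 * k + 1"] hpell_pos[of "2 * k"] pell_nonneg[of "2 * k"]
    by (simp_all add: x_def pell_Suc)
  have cop: "coprime (3 * x + 4 * g + 2) x"
  proof (rule coprimeI_bezout)
    \<comment> \<open>In balancing numbers the left side is the quadratic form of
      \<open>bal_norm\<close>.\<close>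
    show "- bal k * (3 * x + 4 * g + 2) + bal (Suc k) * x = 1"
    proof -
      have y: "3 * x + 4 * g + 2 = 5 * bal (Suc k) - bal k"
        using h hb by (simp add: x)
      show ?thesis
        using bal_norm[of k] unfolding y unfolding x
        by (simp add: power2_eq_square algebra_simps)
    qed
  qed
  have "(x + g + 1, x + g, euclid (3 * x + 4 * g + 2) x) \<in> ECal"
  proof (rule ECal_euclid[OF _ _ cop])
    show "(3 * x + 4 * g + 2) * x = 2 * (x + g + 1) * (x + g) + 1"
      using norm by (simp add: power2_eq_square algebra_simps)
    show "good (x + g + 1 + (x + g) - x)
        ({#x + g + 1 - x, x + g - x#} + mset (euclid (3 * x + 4 * g + 2 - x) x))"
      using good_pell_odd[OF h] by (simp add: x_def algebra_simps)
  qed (use pos in simp_all)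
  moreover have "E_beta (2 * k + 1)
      = rat_of_class (x + g + 1, x + g, euclid (3 * x + 4 * g + 2) x)"
    using denom_mult_weight_divide[OF cop] pos P
    by (simp add: E_beta_def rat_of_class_def W_def beta_def X P) (simp add: field_simps)
  ultimately show ?thesis
    by blast
qed

section \<open>The classes E(\<alpha>_n)\<close>

lemma E_alpha_odd: "E_alpha (2 * m + 1) \<in> rat_of_class ` ECal"
proof -
  define P where "P = pell (2 * m + 1)"
  define h where "h = hpell (2 * m + 1)"
  have X: "pell (Suc (2 * m)) = P"
    by (simp add: P_def)
  have H: "hpell (2 * m + 2) = h + 2 * P"
    by (simp add: hpell_Suc h_def P_def)
  have Pb: "P = bal (Suc m) - bal m" and hb: "h = bal (Suc m) + bal m"
    using pell_hpell_bal(2,4)[of m] by (simp_all add: P_def h_def)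
  have norm: "h\<^sup>2 + 1 = 2 * P\<^sup>2"
    using bal_norm[of m] by (simp add: Pb hb power2_eq_square algebra_simps)
  then have norm': "(h + 2 * P)\<^sup>2 + 2 * P\<^sup>2 + 1 = 4 * P * (h + 2 * P)"
    by (simp add: power2_eq_square algebra_simps)
  have pos: "1 \<le> P" "1 \<le> h"
    using bal_Suc_ge2[of m] bal_nonneg[of m] bal_Suc_pos[of m] unfolding Pb hb by linarith+
  note cop = coprime_squares[OF norm']
  have "good (4 * bal (Suc m) - 2 * bal m)
      ({#2 * bal (Suc m) - bal m, 2 * bal (Suc m) - bal m, 2 * bal (Suc m) - bal m,
         bal (Suc m), P, P, P#} + (bal_blocks m + bal_blocks m + {#1#}))"
    unfolding Pb by (intro good_odd_end bal_nonneg bal_Suc_ge2 bal_rest_le good_bal)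
  moreover have "mset (euclid (7 * bal (Suc m) - 3 * bal m) (2 * bal (Suc m) - bal m))
      = {#2 * bal (Suc m) - bal m, 2 * bal (Suc m) - bal m, 2 * bal (Suc m) - bal m,
          bal (Suc m), P#} + bal_blocks m"
    by (simp add: euclid_odd_end[OF bal_nonneg bal_Suc_gt] mset_euclid_bal Pb)
  moreover have "{#P, P#} + ({#A, A, A, B, P#} + S) + (S + {#1#})
      = {#A, A, A, B, P, P, P#} + (S + S + {#1#})" for A B and S :: "int multiset"
    by simp
  \<comment> \<open>With \<open>c = P\<close>, \<open>f 0 = 2\<close> and \<open>g 0 = 1\<close>,
    the tuple of \<open>good_bal_product\<close> at the centre is that of
    \<open>good_odd_end\<close>.\<close>
  moreover have "P * (2 * 2 + 4 * 1) + 5 * bal m - bal (Suc m) = 7 * bal (Suc m) - 3 * bal m"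
    "P * 2 + bal m = 2 * bal (Suc m) - bal m"
    "P * 2 + 2 * P * 1 + 2 * bal m = 4 * bal (Suc m) - 2 * bal m"
    by (simp_all add: Pb)
  moreover have "2 * pell (2 * 0 + 1) = 2" "hpell (2 * 0 + 1) = 1"
    by simp_all
  ultimately have base: "good (P * (2 * pell (2 * 0 + 1)) + 2 * P * hpell (2 * 0 + 1) + 2 * bal m)
      ({#P * hpell (2 * 0 + 1), P * hpell (2 * 0 + 1)#}
      + mset (euclid (P * (2 * (2 * pell (2 * 0 + 1)) + 4 * hpell (2 * 0 + 1)) + 5 * bal m
          - bal (Suc m)) (P * (2 * pell (2 * 0 + 1)) + bal m))
      + (bal_blocks m + {#1#}))"
    by (simp only: mult_1_right)
  have two_pell: "1 \<le> 2 * pell (Suc i)" for i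
    using pell_Suc_pos[of i] by simp
  have "bal m \<le> P"
    using bal_Suc_ge2[of m] by (simp add: Pb)
  \<comment> \<open>The outer end \<open>k = m\<close>, \<open>i = 0\<close>, where
    \<open>f m = 2 * P\<close> and \<open>g m = h\<close>. There \<open>bal (Suc 0) = 1\<close>
    becomes the -1 in the difference of numerator and denominator, and of the tail only the appended
    1 remains.\<close>
  have "good (P * (2 * P) + 2 * P * h + 2 * bal 0) ({#P * h, P * h#}
      + mset (euclid (P * (2 * (2 * P) + 4 * h) + 5 * bal 0 - bal (Suc 0)) (P * (2 * P) + bal 0))
      + (bal_blocks 0 + {#1#}))"
    unfolding P_def h_def
    by (rule good_bal_product[where f = "\<lambda>k. 2 * pell (2 * k + 1)" and g = "\<lambda>k. hpell (2 * k + 1)"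
        and i = 0 and k = m, OF _ _ _ _ _ _ base[unfolded P_def]])
      (use pos \<open>bal m \<le> P\<close> two_pell hpell_pos pell_Suc_pos[of "2 * m"]
        in \<open>simp_all add: pell_hpell_Suc_Suc P_def\<close>)
  then have good: "good (2 * P\<^sup>2 + 2 * P * h)
      ({#P * h, P * h#} + mset (euclid (4 * P\<^sup>2 + 4 * P * h - 1) (2 * P\<^sup>2)) + {#1#})"
    by (simp add: power2_eq_square algebra_simps)
  have "(P * (h + 2 * P), P * (h + 2 * P), euclid ((h + 2 * P)\<^sup>2) (2 * P\<^sup>2) @ [1]) \<in> ECal"
  proof (rule ECal_euclid_append[OF _ _ cop])
    have diff: "(h + 2 * P)\<^sup>2 - 2 * P\<^sup>2 = 4 * P\<^sup>2 + 4 * P * h - 1"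
      using norm by (simp add: power2_eq_square algebra_simps)
    show "good (2 * (P * (h + 2 * P)) - 2 * P\<^sup>2)
      ({#P * (h + 2 * P) - 2 * P\<^sup>2, P * (h + 2 * P) - 2 * P\<^sup>2#}
        + mset (euclid ((h + 2 * P)\<^sup>2 - 2 * P\<^sup>2) (2 * P\<^sup>2)) + {#1#})"
      unfolding diff using good by (simp add: power2_eq_square algebra_simps)
    have "0 \<le> P * h" "0 \<le> P * P" "0 \<le> h * h"
      using pos by simp_all
    then show "2 * P\<^sup>2 \<le> (h + 2 * P)\<^sup>2"
      by (simp add: power2_eq_square algebra_simps)
  qed (use pos norm' in \<open>simp_all add: power2_eq_square algebra_simps\<close>)
  moreover have "E_alpha (2 * m + 1)
      = rat_of_class (P * (h + 2 * P), P * (h + 2 * P), euclid ((h + 2 * P)\<^sup>2) (2 * P\<^sup>2) @ [1])"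
    using denom_mult_weight_divide[OF cop] pos H
    by (simp add: E_alpha_def rat_of_class_def W'_def alpha_def X)
  ultimately show ?thesis
    by blast
qed

text \<open>Treated separately: the centre for even n is built on H_2 = 3 and P_2 = 2, so that
  family begins at n = 2.\<close>

lemma E_alpha_0: "E_alpha 0 \<in> rat_of_class ` ECal"
proof -
  have eu: "euclid 2 1 = [1, 1]" "euclid 1 1 = [1]"
    by (simp_all add: euclid.simps numeral_2_eq_2)
  have "{#0, 1, 1, 0#} = {#1, 1, 0, 0 :: int#}"
    by simp
  then have "good 1 {#1, 1, 0, 0#}"
    using good_zero[OF good_base_110] by metis
  then have "(1, 1, euclid 2 1 @ [1]) \<in> ECal"
    by (intro ECal_euclid_append) (simp_all add: eu)
  moreover have "E_alpha 0 = rat_of_class (1, 1, euclid 2 1 @ [1])"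
    using denom_mult_weight_divide[of 2 1] by (simp add: E_alpha_def rat_of_class_def W'_def alpha_def)
  ultimately show ?thesis
    by blast
qed

lemma E_alpha_even: "E_alpha (2 * m + 2) \<in> rat_of_class ` ECal"
proof -
  define P where "P = pell (2 * m + 2)"
  define h where "h = hpell (2 * m + 2)"
  have X: "hpell (Suc (Suc (2 * m))) = h"
    by (simp add: h_def)
  have H: "pell (2 * m + 3) = h + P"
    by (simp add: pell_Suc h_def P_def numeral_3_eq_3)
  have Pb: "P = 2 * bal (Suc m)" and hb: "h = 3 * bal (Suc m) - bal m"
    using pell_hpell_bal[of "Suc m"] by (simp_all add: P_def h_def)
  have norm: "h\<^sup>2 = 2 * P\<^sup>2 + 1"
    using bal_norm[of m] by (simp add: Pb hb power2_eq_square algebra_simps)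
  then have norm': "h\<^sup>2 + 2 * (h + P)\<^sup>2 + 1 = 4 * (h + P) * h"
    by (simp add: power2_eq_square algebra_simps)
  have pos: "1 \<le> P" "1 \<le> h"
    using bal_Suc_ge2[of m] bal_nonneg[of m] bal_Suc_pos[of m] unfolding Pb hb by linarith+
  have cop: "coprime (2 * (h + P)\<^sup>2) (h\<^sup>2)"
    using coprime_squares[OF norm'] by (simp add: coprime_commute)
  have "good (21 * bal (Suc m) - 5 * bal m)
      ({#9 * bal (Suc m) - 2 * bal m, 9 * bal (Suc m) - 2 * bal m,
         9 * bal (Suc m) - 2 * bal m, 9 * bal (Suc m) - 2 * bal m,
         6 * bal (Suc m) - 2 * bal m, 6 * bal (Suc m) - 2 * bal m,
         5 * bal (Suc m) - bal m, 4 * bal (Suc m) - bal m, bal (Suc m), bal (Suc m), bal (Suc m),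
         bal (Suc m) - bal m#} + (bal_blocks m + bal_blocks m + {#1#}))"
    by (intro good_even_end good_two_moves bal_nonneg bal_Suc_ge2 bal_rest_le good_bal)
  moreover have "mset (euclid (41 * bal (Suc m) - 9 * bal m) (9 * bal (Suc m) - 2 * bal m))
      = {#9 * bal (Suc m) - 2 * bal m, 9 * bal (Suc m) - 2 * bal m,
          9 * bal (Suc m) - 2 * bal m, 9 * bal (Suc m) - 2 * bal m,
          5 * bal (Suc m) - bal m, 4 * bal (Suc m) - bal m, bal (Suc m), bal (Suc m), bal (Suc m),
          bal (Suc m) - bal m#} + bal_blocks m"
    by (simp add: euclid_even_end[OF bal_nonneg bal_Suc_gt] mset_euclid_bal)
  moreover have "{#E, E#} + ({#A, A, A, A, B, C, p, p, p, q#} + S) + (S + {#1#})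
      = {#A, A, A, A, E, E, B, C, p, p, p, q#} + (S + S + {#1#})"
    for A B C E p q and S :: "int multiset"
    by simp
  \<comment> \<open>With \<open>c = h\<close>, \<open>f 0 = 3\<close> and \<open>g 0 = 2\<close>,
    the centre matches \<open>good_even_end\<close>.\<close>
  moreover have "h * (2 * 3 + 4 * 2) + 5 * bal m - bal (Suc m) = 41 * bal (Suc m) - 9 * bal m"
    "h * 3 + bal m = 9 * bal (Suc m) - 2 * bal m"
    "h * 3 + 2 * h * 2 + 2 * bal m = 21 * bal (Suc m) - 5 * bal m"
    "h * 2 = 6 * bal (Suc m) - 2 * bal m"
    by (simp_all add: hb)
  moreover have "hpell (2 * 0 + 2) = 3" "pell (2 * 0 + 2) = 2"
    by (simp_all add: pell_hpell_Suc_Suc numeral_2_eq_2)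
  ultimately have base: "good (h * hpell (2 * 0 + 2) + 2 * h * pell (2 * 0 + 2) + 2 * bal m)
      ({#h * pell (2 * 0 + 2), h * pell (2 * 0 + 2)#}
      + mset (euclid (h * (2 * hpell (2 * 0 + 2) + 4 * pell (2 * 0 + 2)) + 5 * bal m
          - bal (Suc m)) (h * hpell (2 * 0 + 2) + bal m))
      + (bal_blocks m + {#1#}))"
    by (simp only:)
  have growth: "1 \<le> 3 * hpell i + 4 * pell i" "0 < 3 * hpell i + 4 * pell i"
    "1 \<le> 2 * hpell i + 3 * pell i" for i
    using hpell_pos[of i] pell_nonneg[of i] by linarith+
  have "bal m \<le> h"
    using bal_Suc_ge2[of m] bal_nonneg[of m] unfolding hb by linarith
  have "good (h * h + 2 * h * P + 2 * bal 0) ({#h * P, h * P#}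
      + mset (euclid (h * (2 * h + 4 * P) + 5 * bal 0 - bal (Suc 0)) (h * h + bal 0))
      + (bal_blocks 0 + {#1#}))"
    unfolding P_def h_def
    by (rule good_bal_product[where f = "\<lambda>k. hpell (2 * k + 2)" and g = "\<lambda>k. pell (2 * k + 2)"
        and i = 0 and k = m, OF _ _ _ _ _ _ base[unfolded h_def]])
      (use pos \<open>bal m \<le> h\<close> growth
        in \<open>simp_all add: pell_hpell_Suc_Suc h_def\<close>)
  then have good: "good (h\<^sup>2 + 2 * h * P)
      ({#h * P, h * P#} + mset (euclid (2 * h\<^sup>2 + 4 * h * P - 1) (h\<^sup>2)) + {#1#})"
    by (simp add: power2_eq_square algebra_simps)
  have "((h + P) * h, (h + P) * h, euclid (2 * (h + P)\<^sup>2) (h\<^sup>2) @ [1]) \<in> ECal"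
  proof (rule ECal_euclid_append[OF _ _ cop])
    have diff: "2 * (h + P)\<^sup>2 - h\<^sup>2 = 2 * h\<^sup>2 + 4 * h * P - 1"
      using norm by (simp add: power2_eq_square algebra_simps)
    show "good (2 * ((h + P) * h) - h\<^sup>2)
      ({#(h + P) * h - h\<^sup>2, (h + P) * h - h\<^sup>2#}
        + mset (euclid (2 * (h + P)\<^sup>2 - h\<^sup>2) (h\<^sup>2)) + {#1#})"
      unfolding diff using good by (simp add: power2_eq_square algebra_simps)
    have "0 \<le> P * h" "0 \<le> P * P" "0 \<le> h * h"
      using pos by simp_all
    then show "h\<^sup>2 \<le> 2 * (h + P)\<^sup>2"
      by (simp add: power2_eq_square algebra_simps)
  qed (use pos norm' in \<open>simp_all add: power2_eq_square algebra_simps\<close>)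
  moreover have "E_alpha (2 * m + 2)
      = rat_of_class ((h + P) * h, (h + P) * h, euclid (2 * (h + P)\<^sup>2) (h\<^sup>2) @ [1])"
    using denom_mult_weight_divide[OF cop] pos H
    by (simp add: E_alpha_def rat_of_class_def W'_def alpha_def X numeral_3_eq_3)
  ultimately show ?thesis
    by blast
qed

theorem theorem5p1:
  fixes n :: nat
  shows "E_alpha n \<in> rat_of_class ` ECal \<and> E_beta n \<in> rat_of_class ` ECal"
proof
  show "E_beta n \<in> rat_of_class ` ECal"
    using E_beta_even E_beta_odd by (cases "even n") (auto elim!: evenE oddE)
  show "E_alpha n \<in> rat_of_class ` ECal"
  proof (cases "even n")
    case True
    then obtain k where "n = 2 * k"
      by (rule evenE)
    then show ?thesis
      using E_alpha_0 E_alpha_even by (cases k) (simp_all add: algebra_simps)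
  qed (use E_alpha_odd in \<open>auto elim!: oddE\<close>)
qed

end
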